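(* Let $\mathcal{A}$ be a commutative, associative, unital, finite-dimensional real algebra and $n\ge1$. Suppose $\alpha\in\mathbf{zd}(\mathcal{A})$ is nonzero and $p(D)=\alpha D^n+q(D)$, where $q(D)\in\mathcal{A}[D]$ has degree at most $n-1$ and $q(D)$ is not a multiple of $\alpha$. Then for any $\zeta_o\in\mathcal{A}$ there exist $c_0,c_1,\dots,c_{n-1}\in\mathcal{A}$ such that no solution $\eta$ of $p(D)[\eta]=0$ (defined on an open set containing $\zeta_o$) satisfies $$\eta(\zeta_o)=c_0,\ \eta'(\zeta_o)=c_1,\ \dots,\ \eta^{(n-1)}(\zeta_o)=c_{n-1}.$$
   Context: $\mathbf{zd}(\mathcal{A})=\{x\in\mathcal{A}: x=0\text{ or }x\text{ is a zero-divisor}\}$. For $U\subseteq\mathcal{A}$ open, $f:U\to\mathcal{A}$ is $\mathcal{A}$-differentiable at $p$ if there is a real-linear map $d_pf:\mathcal{A}\to\mathcal{A}$ with $d_pf(xy)=d_pf(x)y$ for all $x,y\in\mathcal{A}$ and $\lim_{h\to0}\frac{f(p+h)-f(p)-d_pf(h)}{\|h\|}=0$ (any norm); then $f'(p)=d_pf(1)$, and higher derivatives are defined by iteration. $D=d/d\zeta$ is $\mathcal{A}$-differentiation, and $\mathcal{A}[D]$ is the commutative ring of operators $\sum_i a_iD^i$, $a_i\in\mathcal{A}$ (isomorphic to the polynomial ring $\mathcal{A}[x]$). $q(D)$ is a multiple of $\alpha$ if $q(D)=\alpha\, r(D)$ for some $r(D)\in\mathcal{A}[D]$. A solution of $p(D)[\eta]=0$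 is an $n$-times $\mathcal{A}$-differentiable function satisfying the equation on its domain. *)

theory Defs
  imports "HOL-Analysis.Analysis" "HOL-Computational_Algebra.Polynomial"
begin

text \<open>
  A commutative, associative, unital real algebra with a norm is a type of sort
  \<open>{real_normed_vector, real_algebra_1, comm_ring_1}\<close>. The norm is only a norm on the
  underlying real vector space: no relation to the product is imposed.  Finite-dimensionality is
  not part of the sort; it is the hypothesis \<open>fin_dim\<close>.
\<close>

definition fin_dim :: "'a::real_vector itself \<Rightarrow> bool" where
  "fin_dim _ \<longleftrightarrow> (\<exists>B :: 'a set. finite B \<and> span B = UNIV)"

definition zd :: "'a::comm_ring_1 set" where
  "zd = {x. x = 0 \<or> (\<exists>y. y \<noteq> 0 \<and> x * y = 0)}"

text \<open>
  Functions on an open set \<open>U\<close> are represented by total functions; all notions below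
  depend only on the germ of the function at the point considered.  The boundedness
  of \<open>L\<close> included in \<open>has_derivative\<close> is automatic in finite dimension.
\<close>

definition has_A_derivative ::
    "('a::{real_normed_vector, real_algebra_1, comm_ring_1} \<Rightarrow> 'a) \<Rightarrow> ('a \<Rightarrow> 'a) \<Rightarrow> 'a \<Rightarrow> bool" where
  "has_A_derivative f L p \<longleftrightarrow>
     (f has_derivative L) (at p) \<and> (\<forall>x y. L (x * y) = L x * y)"

definition A_differentiable ::
    "('a::{real_normed_vector, real_algebra_1, comm_ring_1} \<Rightarrow> 'a) \<Rightarrow> 'a \<Rightarrow> bool" where
  "A_differentiable f p \<longleftrightarrow> (\<exists>L. has_A_derivative f L p)"

definition A_deriv ::
    "('a::{real_normed_vector, real_algebra_1, comm_ring_1} \<Rightarrow> 'a) \<Rightarrow> 'a \<Rightarrow> 'a" where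
  "A_deriv f p = (THE L. has_A_derivative f L p) 1"

lemma A_deriv_eq: "has_A_derivative f L p \<Longrightarrow> A_deriv f p = L 1"
  unfolding A_deriv_def
  by (subst the_equality[where a = L]) (auto simp: has_A_derivative_def intro: has_derivative_unique)

definition n_times_A_differentiable_on ::
    "nat \<Rightarrow> ('a::{real_normed_vector, real_algebra_1, comm_ring_1} \<Rightarrow> 'a) \<Rightarrow> 'a set \<Rightarrow> bool" where
  "n_times_A_differentiable_on n f U \<longleftrightarrow>
     (\<forall>k<n. \<forall>z\<in>U. A_differentiable ((A_deriv ^^ k) f) z)"

text \<open>
  The operator \<open>p(D) = \<Sum>i. a\<^sub>i D\<^sup>i\<close> is represented by the polynomial \<open>p\<close> with
  coefficients \<open>a\<^sub>i\<close>; composition of operators is multiplication in \<^typ>\<open>'a poly\<close>.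
\<close>

definition diff_op ::
    "'a::{real_normed_vector, real_algebra_1, comm_ring_1} poly \<Rightarrow> ('a \<Rightarrow> 'a) \<Rightarrow> 'a \<Rightarrow> 'a" where
  "diff_op p f z = (\<Sum>i\<le>degree p. coeff p i * (A_deriv ^^ i) f z)"

definition is_multiple_of :: "'a::comm_ring_1 poly \<Rightarrow> 'a \<Rightarrow> bool" where
  "is_multiple_of q \<alpha> \<longleftrightarrow> (\<exists>r. q = smult \<alpha> r)"

definition is_solution_on ::
    "'a::{real_normed_vector, real_algebra_1, comm_ring_1} poly \<Rightarrow> ('a \<Rightarrow> 'a) \<Rightarrow> 'a set \<Rightarrow> bool" where
  "is_solution_on p \<eta> U \<longleftrightarrow>
     open U \<and> n_times_A_differentiable_on (degree p) \<eta> U \<and> (\<forall>z\<in>U. diff_op p \<eta> z = 0)"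

end

theory Submission
  imports Defs
begin

text \<open>
  Since \<open>q\<close> is not a multiple of \<open>\<alpha>\<close>, some coefficient \<open>b\<^sub>j\<close> of \<open>q\<close> lies outside
  the ideal generated by \<open>\<alpha>\<close>.  For the initial data \<open>c\<^sub>j = 1\<close> and \<open>c\<^sub>k = 0\<close> otherwise, the
  equation evaluated at \<open>\<zeta>\<^sub>o\<close> reads \<open>\<alpha> * \<eta>\<^sup>(\<^sup>n\<^sup>)(\<zeta>\<^sub>o) + b\<^sub>j = 0\<close>, which is
  impossible.
\<close>

text \<open>The quotients \<open>g i\<close> are chosen index by index and need not vanish where
  \<open>coeff q i = 0\<close>, since \<alpha> may be a zero divisor; cutting the sum off at
  \<open>degree q\<close> turns them into a polynomial.\<close>

lemma is_multiple_of_iff_coeff: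
  "is_multiple_of q \<alpha> \<longleftrightarrow> (\<forall>i. \<alpha> dvd coeff q i)"
proof
  assume "is_multiple_of q \<alpha>"
  then show "\<forall>i. \<alpha> dvd coeff q i"
    by (auto simp: is_multiple_of_def)
next
  assume "\<forall>i. \<alpha> dvd coeff q i"
  then obtain g where g: "\<And>i. coeff q i = \<alpha> * g i"
    unfolding dvd_def by metis
  have "q = (\<Sum>i\<le>degree q. monom (coeff q i) i)"
    by (rule poly_as_sum_of_monoms[symmetric])
  also have "\<dots> = smult \<alpha> (\<Sum>i\<le>degree q. monom (g i) i)"
    by (rule poly_eqI) (simp add: g coeff_sum sum_distrib_left if_distrib cong: if_cong)
  finally show "is_multiple_of q \<alpha>"
    unfolding is_multiple_of_def by blast
qed

theorem theorem6p5:
  fixes \<alpha> :: "'a::{real_normed_vector, real_algebra_1, comm_ring_1}"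
    and p q :: "'a poly" and n :: nat and \<zeta>\<^sub>o :: 'a
  assumes "fin_dim TYPE('a)"
    and "n \<ge> 1"
    and "\<alpha> \<in> zd" and "\<alpha> \<noteq> 0"
    and "p = monom \<alpha> n + q"
    and "degree q \<le> n - 1"
    and "\<not> is_multiple_of q \<alpha>"
  shows "\<exists>c :: nat \<Rightarrow> 'a. \<not> (\<exists>U \<eta>. \<zeta>\<^sub>o \<in> U \<and> is_solution_on p \<eta> U \<and>
           (\<forall>k<n. (A_deriv ^^ k) \<eta> \<zeta>\<^sub>o = c k))"
proof -
  obtain j where j: "\<not> \<alpha> dvd coeff q j"
    using assms(7) by (auto simp: is_multiple_of_iff_coeff)
  have deg_q: "degree q < n"
    using assms(2,6) by linarith
  \<comment> \<open>As \<alpha> divides 0, \<open>j\<close> cannot lie beyond the degree, so initial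
    data are prescribed at \<open>j\<close>.\<close>
  have "j \<le> degree q"
    using j by (metis dvd_0_right le_degree)
  then have "j < n"
    using deg_q by linarith
  \<comment> \<open>Since \<alpha> is nonzero, the leading term survives and
    \<open>diff_op p\<close> sums up to exactly \<open>n\<close>.\<close>
  have deg_p: "degree p = n"
    using deg_q assms(4) by (simp add: assms(5) degree_add_eq_left degree_monom_eq)
  have coeff_n: "coeff p n = \<alpha>"
    using deg_q by (simp add: assms(5) coeff_eq_0)
  have coeff_less: "coeff p i = coeff q i" if "i < n" for i
    using that by (simp add: assms(5))
  have False
    if "\<zeta>\<^sub>o \<in> U" "is_solution_on p \<eta> U"
      and init: "\<forall>k<n. (A_deriv ^^ k) \<eta> \<zeta>\<^sub>o = (if k = j then 1 else 0)" for U \<eta>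
  proof -
    have "0 = (\<Sum>i\<le>n. coeff p i * (A_deriv ^^ i) \<eta> \<zeta>\<^sub>o)"
      using that(1,2) by (simp add: is_solution_on_def diff_op_def deg_p)
    also have "\<dots> = (\<Sum>i<n. coeff p i * (A_deriv ^^ i) \<eta> \<zeta>\<^sub>o) + \<alpha> * (A_deriv ^^ n) \<eta> \<zeta>\<^sub>o"
      by (simp add: lessThan_Suc_atMost[symmetric] coeff_n)
    also have "(\<Sum>i<n. coeff p i * (A_deriv ^^ i) \<eta> \<zeta>\<^sub>o) = (\<Sum>i<n. if i = j then coeff q i else 0)"
      by (intro sum.cong) (auto simp: init coeff_less)
    also have "\<dots> = coeff q j"
      using \<open>j < n\<close> by simp
    \<comment> \<open>The derivative of order \<open>n\<close> is left free by the initial data, but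
      it enters only through a multiple of \<alpha>.\<close>
    finally have "coeff q j = \<alpha> * - (A_deriv ^^ n) \<eta> \<zeta>\<^sub>o"
      by (simp add: eq_neg_iff_add_eq_0)
    with j show False
      by (metis dvd_triv_left)
  qed
  then show ?thesis
    by (intro exI[of _ "\<lambda>k. if k = j then 1 else 0"]) blast
qed

end
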